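(* Let $M_0, M_1, \dots, M_n$ be Event-B machines such that $M_0 \preccurlyeq_W M_1 \preccurlyeq_W \cdots \preccurlyeq_W M_n$ is a refinement chain obeying the development strategy described in the context, in which no event is renamed or split (so that $\alpha M_{k}\subseteq\alpha M_{k+1}$, and an event of $M_{k+1}$ refines an event of $M_k$ exactly when it is that same event). If $M_n$ is deadlock free and $M_n$ does not contain any anticipated events, then $$M_n \models G\,F\Big(\bigvee_{e\in\alpha M_0}[e]\Big).$$
   Context: Fix an infinite set $\Sigma$ of event names. **Machines.** An Event-B machine $M$ has a set of states (values $v$ of its variables), an invariant $I(v)$, a non-empty set of initial states, and a finite set $\alpha M\subseteq\Sigma$ of events (its alphabet; initialisation is not in it). Each event $e$ has a guard $G_e(x,v)$ and a before-after predicate $BA_e(v,x,v')$, where $x$ are the (optional) parameters. Event $e$ is enabled in $v$ if $\exists x.\,G_e(x,v)$; write $v\xrightarrow{e}v'$ if $\exists x.\,G_e(x,v)\wedge BA_e(v,x,v')$. All initial states satisfy $I$, and $I(v)$ and $v\xrightarrow{e}v'$ imply $I(v')$. Events are feasible: if $I(v)$ holds and $e$ is enabled in $v$ then $v\xrightarrow{e}v'$ for some $v'$. $M$ is deadlock free if in every state satisfying $I$ at least one event is enabled. Every event carries exactly one label: ordinary, anticipated or convergent. **Traces.** A trace of $M$ is a maximal execution: either an infinite sequence $\langle e_0,e_1,\dots\rangle$ of events such that $v_0\xrightarrow{e_0}v_1\xrightarrow{e_1}\cdots$ for some states with $v_0$ initial, or a finite sequence $\langle e_0,\dots,e_{k-1}\rangle$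 with $v_0\xrightarrow{e_0}\cdots\xrightarrow{e_{k-1}}v_k$, $v_0$ initial, and no event enabled in $v_k$. **Refinement.** Let $M$ (states $v$, invariant $I$) and $M'$ (states $w$, invariant $I'$) be machines, with a specification of which events of $M'$ refine which events of $M$ (each event of $M'$ refines at most one event of $M$; an event refining none is called new). $M\preccurlyeq_W M'$ means there are a linking invariant $J(v,w)$ and a natural-number-valued variant $V(w)$ such that: every initial $w$ has an initial $v$ with $J(v,w)$; and for all $v,w$ with $I(v), I'(w), J(v,w)$ and all $e'\in\alpha M'$: (feasibility) if $e'$ is enabled in $w$ then $w\xrightarrow{e'}w'$ for some $w'$; (guard strengthening) if $e'$ refines $e$ and $e'$ is enabled in $w$ then $e$ is enabled in $v$; (simulation) if $w\xrightarrow{e'}w'$ and $e'$ refines $e$ then there is $v'$ with $v\xrightarrow{e}v'$ and $J(v',w')$, while if $w\xrightarrow{e'}w'$ and $e'$ is new then $J(v,w')$; (variant) if $w\xrightarrow{e'}w'$ then $V(w')<V(w)$ when $e'$ is convergent and $V(w')\le V(w)$ when $e'$ is anticipated. **Development strategy** for a chain $M_0\preccurlyeq_W\cdots\preccurlyeq_W M_n$: all events of $M_0$ are ordinary; each event of $M_k$ is refined by at least one event of $M_{k+1}$; each new event of $M_{k+1}$ is anticipated or convergent; each event of $M_{k+1}$ refining an anticipated event of $M_k$ is anticipated or convergent; each event of $M_{k+1}$ refining a convergent or ordinary event of $M_k$ is ordinary. **LTL.** Formulae: $\phi::=true\mid[x]\mid\neg\phi\mid\phi\vee\phi\mid\phi\,U\,\phi$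 with $x\in\Sigma$. For a finite or infinite sequence $u$ of events, $u^k$ denotes $u$ with its first $k$ elements removed ($k$ ranges over indices not exceeding the length of $u$). $u\models true$ always; $u\models[x]$ iff $u$ is non-empty with first element $x$; $\neg,\vee$ as usual; $u\models\phi_1U\phi_2$ iff there is $k\ge0$ with $u^k\models\phi_2$ and $u^i\models\phi_1$ for all $i<k$. Derived: $u\models F\phi$ iff $u^i\models\phi$ for some $i\ge 0$; $u\models G\phi$ iff $u^i\models\phi$ for all $i\ge 0$. $M\models\phi$ iff every trace of $M$ satisfies $\phi$. *)

theory Defs
  imports Main "HOL-Library.Extended_Nat"
begin

datatype label = Ordinary | Anticipated | Convergent

text \<open>
  The state space is an explicit carrier \<open>states\<close>, so that machines with
  different state spaces can share one type (for instance a disjoint union) and hence occur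
  in one chain. All events share the parameter type; an event without parameters ignores
  the argument, and typing of parameters belongs to the guard. The values of \<open>guard\<close>,
  \<open>before_after\<close> and \<open>label\<close> outside the alphabet are irrelevant.
\<close>

record ('s, 'p, 'e) machine =
  states :: "'s set"
  invariant :: "'s \<Rightarrow> bool"
  init :: "'s set"
  alphabet :: "'e set"
  guard :: "'e \<Rightarrow> 'p \<Rightarrow> 's \<Rightarrow> bool"
  before_after :: "'e \<Rightarrow> 's \<Rightarrow> 'p \<Rightarrow> 's \<Rightarrow> bool"
  label :: "'e \<Rightarrow> label"

definition enabled :: "('s, 'p, 'e) machine \<Rightarrow> 'e \<Rightarrow> 's \<Rightarrow> bool" where
  "enabled M e v \<longleftrightarrow> e \<in> alphabet M \<and> v \<in> states M \<and> (\<exists>x. guard M e x v)"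

definition step :: "('s, 'p, 'e) machine \<Rightarrow> 's \<Rightarrow> 'e \<Rightarrow> 's \<Rightarrow> bool" where
  "step M v e v' \<longleftrightarrow> e \<in> alphabet M \<and> v \<in> states M \<and> v' \<in> states M \<and>
     (\<exists>x. guard M e x v \<and> before_after M e v x v')"

locale event_b_machine =
  fixes M :: "('s, 'p, 'e) machine"
  assumes init_nonempty: "init M \<noteq> {}"
    and init_states: "init M \<subseteq> states M"
    and finite_alphabet: "finite (alphabet M)"
    and init_invariant: "v \<in> init M \<Longrightarrow> invariant M v"
    and step_invariant: "\<lbrakk>invariant M v; step M v e v'\<rbrakk> \<Longrightarrow> invariant M v'"
    and feasible: "\<lbrakk>invariant M v; enabled M e v\<rbrakk> \<Longrightarrow> \<exists>v'. step M v e v'"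

definition deadlock_free :: "('s, 'p, 'e) machine \<Rightarrow> bool" where
  "deadlock_free M \<longleftrightarrow>
     (\<forall>v\<in>states M. invariant M v \<longrightarrow> (\<exists>e\<in>alphabet M. enabled M e v))"

text \<open>
  A map \<open>r\<close> specifies which events are refined: \<open>r e' = Some e\<close> means that
  \<open>e'\<close> refines \<open>e\<close>, and \<open>r e' = None\<close> that \<open>e'\<close> is new.
\<close>

definition refinement_spec ::
  "('e \<rightharpoonup> 'e) \<Rightarrow> ('s, 'p, 'e) machine \<Rightarrow> ('t, 'q, 'e) machine \<Rightarrow> bool" where
  "refinement_spec r M M' \<longleftrightarrow> (\<forall>e'\<in>alphabet M'. \<forall>e. r e' = Some e \<longrightarrow> e \<in> alphabet M)"

definition refines_W ::
  "('e \<rightharpoonup> 'e) \<Rightarrow> ('s, 'p, 'e) machine \<Rightarrow> ('t, 'q, 'e) machine \<Rightarrow> bool" where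
  "refines_W r M M' \<longleftrightarrow> refinement_spec r M M' \<and>
     (\<exists>(J :: 's \<Rightarrow> 't \<Rightarrow> bool) (V :: 't \<Rightarrow> nat).
        (\<forall>w\<in>init M'. \<exists>v\<in>init M. J v w) \<and>
        (\<forall>v\<in>states M. \<forall>w\<in>states M'. \<forall>e'\<in>alphabet M'.
           invariant M v \<and> invariant M' w \<and> J v w \<longrightarrow>
             (enabled M' e' w \<longrightarrow> (\<exists>w'. step M' w e' w')) \<and>
             (\<forall>e. r e' = Some e \<and> enabled M' e' w \<longrightarrow> enabled M e v) \<and>
             (\<forall>w' e. step M' w e' w' \<and> r e' = Some e \<longrightarrow> (\<exists>v'. step M v e v' \<and> J v' w')) \<and>
             (\<forall>w'. step M' w e' w' \<and> r e' = None \<longrightarrow> J v w') \<and>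
             (\<forall>w'. step M' w e' w' \<longrightarrow>
                (label M' e' = Convergent \<longrightarrow> V w' < V w) \<and>
                (label M' e' = Anticipated \<longrightarrow> V w' \<le> V w))))"

definition development_strategy ::
  "nat \<Rightarrow> (nat \<Rightarrow> ('s, 'p, 'e) machine) \<Rightarrow> (nat \<Rightarrow> 'e \<rightharpoonup> 'e) \<Rightarrow> bool" where
  "development_strategy n M r \<longleftrightarrow>
     (\<forall>e\<in>alphabet (M 0). label (M 0) e = Ordinary) \<and>
     (\<forall>k<n.
        (\<forall>e\<in>alphabet (M k). \<exists>e'\<in>alphabet (M (Suc k)). r k e' = Some e) \<and>
        (\<forall>e'\<in>alphabet (M (Suc k)).
           (r k e' = None \<longrightarrow> label (M (Suc k)) e' \<in> {Anticipated, Convergent}) \<and>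
           (\<forall>e. r k e' = Some e \<and> label (M k) e = Anticipated \<longrightarrow>
              label (M (Suc k)) e' \<in> {Anticipated, Convergent}) \<and>
           (\<forall>e. r k e' = Some e \<and> label (M k) e \<in> {Convergent, Ordinary} \<longrightarrow>
              label (M (Suc k)) e' = Ordinary)))"

definition no_renaming_or_splitting ::
  "('e \<rightharpoonup> 'e) \<Rightarrow> ('s, 'p, 'e) machine \<Rightarrow> ('t, 'q, 'e) machine \<Rightarrow> bool" where
  "no_renaming_or_splitting r M M' \<longleftrightarrow> alphabet M \<subseteq> alphabet M' \<and>
     (\<forall>e'\<in>alphabet M'. \<forall>e\<in>alphabet M. r e' = Some e \<longleftrightarrow> e' = e)"

datatype 'e event_seq = Fin "'e list" | Inf "nat \<Rightarrow> 'e"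

primrec seq_length :: "'e event_seq \<Rightarrow> enat" where
  "seq_length (Fin es) = enat (length es)"
| "seq_length (Inf f) = \<infinity>"

primrec suffix :: "nat \<Rightarrow> 'e event_seq \<Rightarrow> 'e event_seq" where
  "suffix k (Fin es) = Fin (drop k es)"
| "suffix k (Inf f) = Inf (\<lambda>i. f (k + i))"

primrec starts_with :: "'e event_seq \<Rightarrow> 'e \<Rightarrow> bool" where
  "starts_with (Fin es) x \<longleftrightarrow> es \<noteq> [] \<and> hd es = x"
| "starts_with (Inf f) x \<longleftrightarrow> f 0 = x"

primrec trace :: "('s, 'p, 'e) machine \<Rightarrow> 'e event_seq \<Rightarrow> bool" where
  "trace M (Fin es) \<longleftrightarrow>
     (\<exists>v :: nat \<Rightarrow> 's. v 0 \<in> init M \<and>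
        (\<forall>i<length es. step M (v i) (es ! i) (v (Suc i))) \<and>
        (\<forall>e\<in>alphabet M. \<not> enabled M e (v (length es))))"
| "trace M (Inf f) \<longleftrightarrow>
     (\<exists>v :: nat \<Rightarrow> 's. v 0 \<in> init M \<and> (\<forall>i. step M (v i) (f i) (v (Suc i))))"

datatype 'e ltl =
    TrueF
  | Event 'e
  | NotF "'e ltl"
  | OrF "'e ltl" "'e ltl"
  | Until "'e ltl" "'e ltl"

primrec sat :: "'e ltl \<Rightarrow> 'e event_seq \<Rightarrow> bool" where
  "sat TrueF u \<longleftrightarrow> True"
| "sat (Event x) u \<longleftrightarrow> starts_with u x"
| "sat (NotF \<phi>) u \<longleftrightarrow> \<not> sat \<phi> u"
| "sat (OrF \<phi> \<psi>) u \<longleftrightarrow> sat \<phi> u \<or> sat \<psi> u"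
| "sat (Until \<phi> \<psi>) u \<longleftrightarrow>
     (\<exists>k. enat k \<le> seq_length u \<and> sat \<psi> (suffix k u) \<and> (\<forall>i<k. sat \<phi> (suffix i u)))"

definition Eventually :: "'e ltl \<Rightarrow> 'e ltl" where
  "Eventually \<phi> = Until TrueF \<phi>"

definition Always :: "'e ltl \<Rightarrow> 'e ltl" where
  "Always \<phi> = NotF (Eventually (NotF \<phi>))"

text \<open>Finite disjunction; the order of the disjuncts is immaterial and the empty one is false.\<close>

definition BigOr :: "'a set \<Rightarrow> ('a \<Rightarrow> 'e ltl) \<Rightarrow> 'e ltl" where
  "BigOr A \<phi> = foldr (\<lambda>a. OrF (\<phi> a)) (SOME as. distinct as \<and> set as = A) (NotF TrueF)"

definition models :: "('s, 'p, 'e) machine \<Rightarrow> 'e ltl \<Rightarrow> bool" where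
  "models M \<phi> \<longleftrightarrow> (\<forall>u. trace M u \<longrightarrow> sat \<phi> u)"

lemma sat_Eventually:
  "sat (Eventually \<phi>) u \<longleftrightarrow> (\<exists>i. enat i \<le> seq_length u \<and> sat \<phi> (suffix i u))"
  by (simp add: Eventually_def)

lemma sat_Always:
  "sat (Always \<phi>) u \<longleftrightarrow> (\<forall>i. enat i \<le> seq_length u \<longrightarrow> sat \<phi> (suffix i u))"
  by (simp add: Always_def sat_Eventually)

lemma sat_BigOr:
  assumes "finite A"
  shows "sat (BigOr A \<phi>) u \<longleftrightarrow> (\<exists>a\<in>A. sat (\<phi> a) u)"
proof -
  define as where "as = (SOME as. distinct as \<and> set as = A)"
  have "\<exists>as. distinct as \<and> set as = A"
    using finite_distinct_list[OF assms] by blast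
  then have "set as = A"
    unfolding as_def by (rule someI2_ex) simp
  moreover have "sat (foldr (\<lambda>a. OrF (\<phi> a)) bs (NotF TrueF)) u \<longleftrightarrow> (\<exists>a\<in>set bs. sat (\<phi> a) u)" for bs
    by (induction bs) auto
  ultimately show ?thesis
    by (simp add: BigOr_def as_def)
qed

end

theory Submission imports Defs begin

text \<open>
  A finite trace would end in a reachable deadlock, so all traces of the last machine are infinite.
  By simulation, such a trace is at every level \<open>k\<close> a run of \<open>M k\<close> that stutters on
  the events outside the alphabet of \<open>M k\<close>. Suppose that events of \<open>M 0\<close> occur only
  finitely often. Then, by induction on \<open>k\<close>, so do the ordinary events of \<open>M k\<close>: once
  they have died out, the variant of level \<open>k\<close> never increases (stuttering leaves it unchanged)
  and every convergent event decreases it, so the convergent events of \<open>M k\<close> die out as well;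
  and every ordinary event of \<open>M (Suc k)\<close> is ordinary or convergent in \<open>M k\<close>. As the last
  machine has no anticipated events, eventually no event would occur at all.
\<close>

text \<open>All levels of the chain are driven by one event sequence \<open>f\<close>, so that
  indices of different levels can be compared. Standing still outside the alphabet is how an
  abstract machine simulates a new event.\<close>

definition stuttering_run ::
  "('s, 'p, 'e) machine \<Rightarrow> (nat \<Rightarrow> 'e) \<Rightarrow> (nat \<Rightarrow> 's) \<Rightarrow> bool" where
  "stuttering_run M f v \<longleftrightarrow> v 0 \<in> init M \<and>
     (\<forall>i. if f i \<in> alphabet M then step M (v i) (f i) (v (Suc i)) else v (Suc i) = v i)"

text \<open>The alphabet test is needed because \<open>label\<close> is arbitrary on foreign
  events.\<close>

definition label_finitely_often ::
  "('s, 'p, 'e) machine \<Rightarrow> (nat \<Rightarrow> 'e) \<Rightarrow> label \<Rightarrow> bool" where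
  "label_finitely_often M f l \<longleftrightarrow>
     (\<forall>\<^sub>F i in sequentially. f i \<in> alphabet M \<longrightarrow> label M (f i) \<noteq> l)"

lemma (in event_b_machine) stuttering_run_reachable:
  assumes "stuttering_run M f v"
  shows "v i \<in> states M \<and> invariant M (v i)"
proof (induction i)
  case 0
  show ?case
    using assms init_states init_invariant by (auto simp: stuttering_run_def)
next
  case (Suc i)
  have "if f i \<in> alphabet M then step M (v i) (f i) (v (Suc i)) else v (Suc i) = v i"
    using assms by (simp add: stuttering_run_def)
  then show ?case
    using Suc step_invariant by (auto simp: step_def split: if_splits)
qed

text \<open>Deadlock freedom speaks only of states satisfying the invariant, so the invariant is
  first carried along the execution to its last state.\<close>

lemma (in event_b_machine) deadlock_free_no_finite_trace:
  assumes "deadlock_free M"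
  shows "\<not> trace M (Fin es)"
proof
  assume "trace M (Fin es)"
  then obtain v where v0: "v 0 \<in> init M"
    and steps: "\<And>i. i < length es \<Longrightarrow> step M (v i) (es ! i) (v (Suc i))"
    and stuck: "\<forall>e\<in>alphabet M. \<not> enabled M e (v (length es))"
    by auto
  have "i \<le> length es \<Longrightarrow> v i \<in> states M \<and> invariant M (v i)" for i
  proof (induction i)
    case 0
    show ?case using v0 init_states init_invariant by auto
  next
    case (Suc i)
    then show ?case using steps[of i] step_invariant by (auto simp: step_def)
  qed
  then show False
    using stuck assms unfolding deadlock_free_def by blast
qed

lemma antimono_from_nat_decreases_finitely_often:
  fixes V :: "nat \<Rightarrow> nat"
  assumes "\<forall>\<^sub>F i in sequentially. V (Suc i) \<le> V i"
  shows "\<forall>\<^sub>F i in sequentially. \<not> V (Suc i) < V i"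
proof -
  obtain m where m: "\<And>i. m \<le> i \<Longrightarrow> V (Suc i) \<le> V i"
    using assms by (auto simp: eventually_sequentially)
  \<comment> \<open>At \<open>k\<close> the monotone tail attains its minimum; from there on it is
    constant.\<close>
  obtain k where k: "m \<le> k" and least: "\<And>i. m \<le> i \<Longrightarrow> V k \<le> V i"
    using ex_has_least_nat[of "\<lambda>i. m \<le> i" m V] by auto
  have "V i \<le> V k" if "k \<le> i" for i
    using that
  proof (induction i rule: dec_induct)
    case (step i)
    then show ?case using m[of i] k by linarith
  qed simp
  then have "\<not> V (Suc i) < V i" if "k \<le> i" for i
    using that least[of "Suc i"] k by (meson leD le_SucI le_trans)
  then show ?thesis by (auto simp: eventually_sequentially)
qed

text \<open>The no-renaming condition only concerns \<open>e \<in> alphabet M\<close>;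
  \<open>refinement_spec\<close> excludes values of \<open>r\<close> outside that alphabet.\<close>

lemma no_renaming_refined_event:
  assumes "refinement_spec r M M'" "no_renaming_or_splitting r M M'" "e' \<in> alphabet M'"
  shows "r e' = (if e' \<in> alphabet M then Some e' else None)"
proof (cases "r e'")
  case None
  then show ?thesis
    using assms by (fastforce simp: no_renaming_or_splitting_def)
next
  case (Some e)
  then show ?thesis
    using assms unfolding refinement_spec_def no_renaming_or_splitting_def by metis
qed

text \<open>The two claims are proved together: the variant conditions hold only at concrete states
  linked by \<open>J\<close> to an abstract state, and the simulating run supplies such a state at
  every index.\<close>

lemma refines_W_stuttering_run:
  fixes M :: "('s, 'p, 'e) machine" and M' :: "('t, 'q, 'e) machine"
  assumes "event_b_machine M" "event_b_machine M'"
    and ref: "refines_W r M M'" and nr: "no_renaming_or_splitting r M M'"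
    and run: "stuttering_run M' f w"
  shows "\<exists>v. stuttering_run M f v"
    and "label_finitely_often M' f Ordinary \<Longrightarrow> label_finitely_often M' f Convergent"
proof -
  interpret M: event_b_machine M by fact
  interpret M': event_b_machine M' by fact
  have spec: "refinement_spec r M M'"
    using ref by (simp add: refines_W_def)
  have sub: "alphabet M \<subseteq> alphabet M'"
    using nr by (simp add: no_renaming_or_splitting_def)
  note r_eq = no_renaming_refined_event[OF spec nr]
  obtain J :: "'s \<Rightarrow> 't \<Rightarrow> bool" and V :: "'t \<Rightarrow> nat" where
    J_init: "\<forall>w\<in>init M'. \<exists>v\<in>init M. J v w" and
    PO: "\<forall>v\<in>states M. \<forall>w\<in>states M'. \<forall>e'\<in>alphabet M'.
      invariant M v \<and> invariant M' w \<and> J v w \<longrightarrow>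
        (enabled M' e' w \<longrightarrow> (\<exists>w'. step M' w e' w')) \<and>
        (\<forall>e. r e' = Some e \<and> enabled M' e' w \<longrightarrow> enabled M e v) \<and>
        (\<forall>w' e. step M' w e' w' \<and> r e' = Some e \<longrightarrow> (\<exists>v'. step M v e v' \<and> J v' w')) \<and>
        (\<forall>w'. step M' w e' w' \<and> r e' = None \<longrightarrow> J v w') \<and>
        (\<forall>w'. step M' w e' w' \<longrightarrow>
           (label M' e' = Convergent \<longrightarrow> V w' < V w) \<and>
           (label M' e' = Anticipated \<longrightarrow> V w' \<le> V w))"
    using ref unfolding refines_W_def by (elim conjE exE) (rule that)
  have simulation: "r e' = Some e \<Longrightarrow> \<exists>v'. step M v e v' \<and> J v' w'"
    and skip: "r e' = None \<Longrightarrow> J v w'"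
    and convergent: "label M' e' = Convergent \<Longrightarrow> V w' < V w"
    and anticipated: "label M' e' = Anticipated \<Longrightarrow> V w' \<le> V w"
    if "v \<in> states M" "invariant M v" "invariant M' w" "J v w" and st: "step M' w e' w'"
    for v w e' w' e
  proof -
    have "e' \<in> alphabet M'" "w \<in> states M'"
      using st by (simp_all add: step_def)
    then show "r e' = Some e \<Longrightarrow> \<exists>v'. step M v e v' \<and> J v' w'"
      "r e' = None \<Longrightarrow> J v w'"
      "label M' e' = Convergent \<Longrightarrow> V w' < V w"
      "label M' e' = Anticipated \<Longrightarrow> V w' \<le> V w"
      using PO that by blast+
  qed
  have w_step: "if f i \<in> alphabet M' then step M' (w i) (f i) (w (Suc i)) else w (Suc i) = w i" for i
    using run by (simp add: stuttering_run_def)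
  have w_ok: "w i \<in> states M'" "invariant M' (w i)" for i
    using M'.stuttering_run_reachable[OF run] by auto
  \<comment> \<open>The abstract run comes from dependent choice: \<open>P\<close> is kept at each
    index, \<open>Q\<close> relates neighbours. The clause for \<open>i = 0\<close> makes the chosen
    run start in an initial state.\<close>
  define P where "P i v \<longleftrightarrow> v \<in> states M \<and> invariant M v \<and> J v (w i) \<and> (i = 0 \<longrightarrow> v \<in> init M)"
    for i v
  define Q where
    "Q i v v' \<longleftrightarrow> (if f i \<in> alphabet M then step M v (f i) v' else v' = v)" for i v v'
  have "\<exists>v. P 0 v"
    using run J_init M.init_states M.init_invariant
    unfolding P_def stuttering_run_def by blast
  moreover have "\<exists>v'. P (Suc i) v' \<and> Q i v v'" if P: "P i v" for i v
  proof -
    have v: "v \<in> states M" "invariant M v" "J v (w i)"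
      using P by (auto simp: P_def)
    show ?thesis
    proof (cases "f i \<in> alphabet M'")
      case True
      then have st: "step M' (w i) (f i) (w (Suc i))"
        using w_step[of i] by simp
      show ?thesis
      proof (cases "f i \<in> alphabet M")
        case inM: True
        then obtain v' where "step M v (f i) v'" "J v' (w (Suc i))"
          using simulation[OF v(1,2) w_ok(2) v(3) st] r_eq[OF True] by auto
        then show ?thesis
          using M.step_invariant[OF v(2)] inM by (auto simp: P_def Q_def step_def)
      next
        case False
        then have "J v (w (Suc i))"
          using skip[OF v(1,2) w_ok(2) v(3) st] r_eq[OF True] by simp
        then show ?thesis using v False by (auto simp: P_def Q_def)
      qed
    next
      \<comment> \<open>By \<open>sub\<close> the event is foreign to both machines, so both stand
        still and \<open>J\<close> persists.\<close>
      case False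
      then show ?thesis
        using v sub w_step[of i] by (auto simp: P_def Q_def)
    qed
  qed
  ultimately obtain v where v: "\<And>i. P i (v i)" "\<And>i. Q i (v i) (v (Suc i))"
    using dependent_nat_choice[of P Q] by auto
  then show "\<exists>v. stuttering_run M f v"
    by (auto simp: stuttering_run_def P_def Q_def intro!: exI[of _ v])

  have decrease: "V (w (Suc i)) < V (w i)"
    if "f i \<in> alphabet M'" "label M' (f i) = Convergent" for i
    using convergent[of "v i" "w i" "f i" "w (Suc i)"] that w_ok[of i] v(1)[of i] w_step[of i]
    by (auto simp: P_def)
  \<comment> \<open>Either the event is foreign and \<open>w\<close> is unchanged, or it is
    convergent or anticipated.\<close>
  have no_increase: "V (w (Suc i)) \<le> V (w i)"
    if "f i \<in> alphabet M' \<longrightarrow> label M' (f i) \<noteq> Ordinary" for i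
    using decrease[of i] anticipated[of "v i" "w i" "f i" "w (Suc i)"] that
      w_ok[of i] v(1)[of i] w_step[of i]
    by (cases "label M' (f i)") (auto simp: P_def split: if_splits)
  assume "label_finitely_often M' f Ordinary"
  then have "\<forall>\<^sub>F i in sequentially. V (w (Suc i)) \<le> V (w i)"
    unfolding label_finitely_often_def by (rule eventually_mono) (rule no_increase)
  then have "\<forall>\<^sub>F i in sequentially. \<not> V (w (Suc i)) < V (w i)"
    by (rule antimono_from_nat_decreases_finitely_often)
  then show "label_finitely_often M' f Convergent"
    unfolding label_finitely_often_def by (rule eventually_mono) (use decrease in blast)
qed

text \<open>Downward induction from \<open>n\<close>: each refinement passes the run one level up
  the abstraction.\<close>

lemma chain_stuttering_run:
  assumes "\<forall>k\<le>n. event_b_machine (M k)"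
    and "\<forall>k<n. refines_W (r k) (M k) (M (Suc k))"
    and "\<forall>k<n. no_renaming_or_splitting (r k) (M k) (M (Suc k))"
    and "stuttering_run (M n) f w" "k \<le> n"
  shows "\<exists>v. stuttering_run (M k) f v"
  using \<open>k \<le> n\<close>
proof (induction k rule: inc_induct)
  case base
  show ?case using assms(4) by blast
next
  case (step k)
  then show ?case
    using refines_W_stuttering_run(1)[of "M k" "M (Suc k)"] assms(1-3) by fastforce
qed

text \<open>New events and refinements of anticipated events are never labelled ordinary.\<close>

lemma development_strategy_ordinary_predecessor:
  assumes "development_strategy n M r" "k < n"
    and "refinement_spec (r k) (M k) (M (Suc k))"
    and "no_renaming_or_splitting (r k) (M k) (M (Suc k))"
    and "e \<in> alphabet (M (Suc k))" "label (M (Suc k)) e = Ordinary"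
  shows "e \<in> alphabet (M k) \<and> label (M k) e \<in> {Ordinary, Convergent}"
proof -
  have r: "r k e = (if e \<in> alphabet (M k) then Some e else None)"
    using no_renaming_refined_event[OF assms(3-5)] .
  have "r k e \<noteq> None" "\<And>e0. r k e = Some e0 \<Longrightarrow> label (M k) e0 \<noteq> Anticipated"
    using assms(1,2,5,6) unfolding development_strategy_def by fastforce+
  then show ?thesis
    using r by (cases "label (M k) e") (auto split: if_splits)
qed

text \<open>The induction carries both labels because a convergent event becomes ordinary one level
  further down.\<close>

lemma chain_label_finitely_often:
  assumes "\<forall>k\<le>n. event_b_machine (M k)"
    and "\<forall>k<n. refines_W (r k) (M k) (M (Suc k))"
    and "development_strategy n M r"
    and "\<forall>k<n. no_renaming_or_splitting (r k) (M k) (M (Suc k))"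
    and "stuttering_run (M n) f w"
    and init: "\<forall>\<^sub>F i in sequentially. f i \<notin> alphabet (M 0)"
    and "k \<le> n"
  shows "label_finitely_often (M k) f Ordinary \<and> label_finitely_often (M k) f Convergent"
  using \<open>k \<le> n\<close>
proof (induction k)
  case 0
  show ?case
    unfolding label_finitely_often_def using init by (auto elim: eventually_mono)
next
  case (Suc k)
  then have k: "k < n" by simp
  then have spec: "refinement_spec (r k) (M k) (M (Suc k))"
    using assms(2) by (simp add: refines_W_def)
  have IH: "\<forall>\<^sub>F i in sequentially. f i \<in> alphabet (M k) \<longrightarrow> label (M k) (f i) \<notin> {Ordinary, Convergent}"
    using Suc unfolding label_finitely_often_def by (auto elim: eventually_elim2)
  have ordinary: "label_finitely_often (M (Suc k)) f Ordinary"
    unfolding label_finitely_often_def using IH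
    by (rule eventually_mono)
      (use development_strategy_ordinary_predecessor[OF assms(3) k spec] assms(4) k in blast)
  obtain v where "stuttering_run (M (Suc k)) f v"
    using chain_stuttering_run[OF assms(1,2,4,5) Suc.prems] by blast
  then show ?case
    using refines_W_stuttering_run(2)[of "M k" "M (Suc k)" "r k" f v] assms(1,2,4) k ordinary by simp
qed

theorem lemma1:
  fixes M :: "nat \<Rightarrow> ('s, 'p, 'e) machine"
    and r :: "nat \<Rightarrow> 'e \<rightharpoonup> 'e"
    and n :: nat
  assumes "infinite (UNIV :: 'e set)"
    and "\<forall>k\<le>n. event_b_machine (M k)"
    and "\<forall>k<n. refines_W (r k) (M k) (M (Suc k))"
    and "development_strategy n M r"
    and "\<forall>k<n. no_renaming_or_splitting (r k) (M k) (M (Suc k))"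
    and "deadlock_free (M n)"
    and "\<forall>e\<in>alphabet (M n). label (M n) e \<noteq> Anticipated"
  shows "models (M n) (Always (Eventually (BigOr (alphabet (M 0)) Event)))"
proof -
  interpret M0: event_b_machine "M 0" using assms(2) by simp
  interpret Mn: event_b_machine "M n" using assms(2) by simp
  have "sat (Always (Eventually (BigOr (alphabet (M 0)) Event))) u" if u: "trace (M n) u" for u
  proof (cases u)
    case (Fin es)
    then show ?thesis
      using u Mn.deadlock_free_no_finite_trace[OF assms(6)] by blast
  next
    case (Inf f)
    then obtain w where w0: "w 0 \<in> init (M n)"
      and w: "\<And>i. step (M n) (w i) (f i) (w (Suc i))"
      using u by auto
    have f: "f i \<in> alphabet (M n)" for i
      using w[of i] by (simp add: step_def)
    have run: "stuttering_run (M n) f w"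
      using w0 w f by (simp add: stuttering_run_def)
    have "\<not> (\<forall>\<^sub>F i in sequentially. f i \<notin> alphabet (M 0))"
    proof
      assume "\<forall>\<^sub>F i in sequentially. f i \<notin> alphabet (M 0)"
      from chain_label_finitely_often[OF assms(2-5) run this order_refl]
      have "\<forall>\<^sub>F i in sequentially. label (M n) (f i) \<noteq> Ordinary \<and> label (M n) (f i) \<noteq> Convergent"
        using f by (simp add: label_finitely_often_def eventually_conj_iff)
      then obtain i where "label (M n) (f i) \<noteq> Ordinary" "label (M n) (f i) \<noteq> Convergent"
        by (auto simp: eventually_sequentially)
      then show False
        using assms(7) f[of i] by (cases "label (M n) (f i)") auto
    qed
    \<comment> \<open>The form \<open>i + j\<close> matches nested suffixes:
      \<open>suffix j (suffix i (Inf f))\<close> starts with \<open>f (i + j)\<close>.\<close>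
    then have "\<exists>j. f (i + j) \<in> alphabet (M 0)" for i
      unfolding eventually_sequentially by (metis le_iff_add)
    then show ?thesis
      by (simp add: Inf sat_Always sat_Eventually sat_BigOr[OF M0.finite_alphabet])
  qed
  then show ?thesis by (simp add: models_def)
qed

end
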